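(* Let $A(n) = \frac{1}{4 \sqrt{3} n} \exp\big(\pi \sqrt{\tfrac{2 n}{3}}\big)$. Let $\{\varepsilon_n\}_{n\ge1}$ be positive reals with $\varepsilon_n \to 0$ and $\varepsilon_n \gg \frac{\log A(n)}{\sqrt{A(n)}}$ as $n\to\infty$. For each $n$ let $\mathcal{S}_n = \{x\in \mathbb{N} : A(n)(1 - \varepsilon_n) \leq x \leq A(n) (1 + \varepsilon_n) \}$ and let $\mathbf{p}_n$ be a random variable uniformly distributed on $\mathcal{S}_n$, i.e. $\mathbb{P}(\mathbf{p}_n = m) = 1/|\mathcal{S}_n|$ if $m\in\mathcal{S}_n$ and $0$ otherwise. Define $\mathbf{\Delta}_k(n) := \min \{ | \mathbf{p}_n- m^k| : m \in \mathbb{Z} \}$ and $\mathbf{M}_k(d) := \max \{ n : \mathbf{\Delta}_k(n) \leq d \}$ (with value $\infty$ allowed if no maximum exists). Then each of the following statements holds with probability 1. (a) For any $d\geq 0$ and $k\geq 2$, $\mathbf{M}_k(d)$ is finite. (b) There are only finitely many $n$ such that $\mathbf{p}_n$ is a perfect power. (c) Let $k \geq 2$ and assume moreover that $\varepsilon_n \gg A(n)^{-1/k}$ as $n \to \infty$. For any $\varepsilon > 0$ and all sufficiently large $d$, \[ \mathbf{M}_k(d) < (4 + \varepsilon) \cdot \frac{3}{2 \pi^2} \left(\frac{k}{k - 1} \right)^2 (\log d)^2 . \] In particular, $\mathbf{M}_k(d) \asymp (\log d)^2$ as $d \to \infty$. (d) For any fixed $d \geq 0$, the sequence $\{ \mathbf{M}_k(d)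 \}_{k=2}^{\infty}$ is bounded.
   Context: For sequences $u_n, v_n>0$, $u_n \gg v_n$ means there is a constant $C>0$ with $u_n \ge C v_n$ for all sufficiently large $n$; $X_d \asymp Y_d$ means $X_d \ll Y_d$ and $Y_d \ll X_d$. A perfect power is an integer of the form $m^k$ with $m\in\mathbb{Z}$ and $k\ge 2$. $\mathbb{N}$ denotes the positive integers. *)

theory Defs
  imports "HOL-Probability.Probability" "HOL-Library.Landau_Symbols"
begin

definition HR :: "nat \<Rightarrow> real" where
  "HR n = 1 / (4 * sqrt 3 * real n) * exp (pi * sqrt (2 * real n / 3))"

definition near_set :: "(nat \<Rightarrow> real) \<Rightarrow> nat \<Rightarrow> nat set" where
  "near_set \<epsilon> n = {x. x \<ge> 1 \<and> HR n * (1 - \<epsilon> n) \<le> real x \<and> real x \<le> HR n * (1 + \<epsilon> n)}"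

(* The infimum is attained, as the values are natural numbers. *)
definition power_dist :: "nat \<Rightarrow> nat \<Rightarrow> nat" where
  "power_dist k x = (INF m::int. nat \<bar>int x - m ^ k\<bar>)"

(* For a realization x of the random sequence. The index set can be empty (for
   instance if no x n is a k-th power and d = 0); the maximum is then 0, so that the
   value is \<infinity> exactly if the index set is infinite. *)
definition last_close :: "(nat \<Rightarrow> nat) \<Rightarrow> nat \<Rightarrow> real \<Rightarrow> enat" where
  "last_close x k d =
     (let N = {n. n \<ge> 1 \<and> real (power_dist k (x n)) \<le> d}
      in if infinite N then \<infinity> else if N = {} then 0 else enat (Max N))"

definition perfect_power :: "int \<Rightarrow> bool" where
  "perfect_power x \<longleftrightarrow> (\<exists>(m::int) (k::nat). k \<ge> 2 \<and> x = m ^ k)"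

end

theory Submission
  imports Defs "HOL-Real_Asymp.Real_Asymp"
begin

text \<open>
  Write \<open>A = HR n\<close> and \<open>s = (k - 1) / k\<close>. Consecutive \<open>k\<close>-th powers of size about \<open>A\<close> are at least
  of order \<open>A\<^sup>s\<close> apart, so for \<open>D \<le> \<surd>A\<close> the point \<open>p n\<close> lies within \<open>D\<close> of a
  \<open>k\<close>-th power with probability at most \<open>(2D + 1) (5 / (A \<epsilon>) + 4 / A\<^sup>s)\<close>. Only the exponents
  \<open>k \<le> 3 ln A\<close> matter, and since \<open>\<epsilon>\<close> is at least of order \<open>ln A / \<surd>A\<close>, for fixed \<open>D\<close> the sum of these
  bounds over \<open>k\<close> is \<open>O(ln A / \<surd>A)\<close>, which is summable over \<open>n\<close>; Borel-Cantelli gives (a), (b) and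
  (d). For (c) take \<open>D = A\<close> to the power \<open>s / 2\<close>: the bound is now of order \<open>1 / D\<close>, again
  summable, so almost surely \<open>ln A < (2 / s) ln d\<close> whenever \<open>n\<close> is large and \<open>p n\<close> is within \<open>d\<close> of
  a \<open>k\<close>-th power. The lower bound on \<open>M\<^sub>k(d)\<close> comes from the trivial power \<open>0\<close>: the distance
  never exceeds \<open>p n \<le> 2 A\<close>.
\<close>

section \<open>Growth of \<open>HR\<close>\<close>

lemma HR_pos: "n \<ge> 1 \<Longrightarrow> HR n > 0"
  by (simp add: HR_def)

lemma HR_at_top: "filterlim HR at_top at_top"
  unfolding HR_def by real_asymp

text \<open>\<open>HR\<close> grows faster than every power of \<open>n\<close>:
  \<open>ln (HR n)\<close> eventually exceeds \<open>(2 / t) * ln n\<close>, so the terms fall below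
  \<open>1 / n^2\<close>.\<close>

lemma summable_HR_powr:
  assumes "t > 0"
  shows "summable (\<lambda>n. HR n powr (-t))"
proof (rule summable_comparison_test_ev)
  show "summable (\<lambda>n. real n powr -2)"
    by (simp add: summable_real_powr_iff)
  have "filterlim (\<lambda>n. ln (HR n) / ln (real n)) at_top sequentially"
    unfolding HR_def by real_asymp
  hence "\<forall>\<^sub>F n in sequentially. 2 / t \<le> ln (HR n) / ln (real n)"
    by (simp add: filterlim_at_top)
  thus "\<forall>\<^sub>F n in sequentially. norm (HR n powr (-t)) \<le> real n powr -2"
    using eventually_gt_at_top[of 1]
  proof eventually_elim
    case (elim n)
    have "2 * ln (real n) \<le> t * ln (HR n)"
      using elim assms by (simp add: field_simps)
    thus ?case using elim HR_pos[of n] by (simp add: powr_def)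
  qed
qed

lemma sqrt_le_quarter:
  fixes x :: real
  assumes "16 \<le> x"
  shows "sqrt x \<le> x / 4"
proof -
  have "4 \<le> sqrt x" using assms real_le_rsqrt[of 4 x] by simp
  hence "4 * sqrt x \<le> sqrt x * sqrt x" using assms by (intro mult_right_mono) auto
  thus ?thesis using assms by simp
qed

lemma summable_ln_HR_div_sqrt: "summable (\<lambda>n. ln (HR n) / sqrt (HR n))"
proof (rule summable_comparison_test_bigo)
  show "summable (\<lambda>n. norm (real n powr -2))"
    by (simp add: summable_real_powr_iff)
  show "(\<lambda>n. ln (HR n) / sqrt (HR n)) \<in> O(\<lambda>n. real n powr -2)"
    unfolding HR_def by real_asymp
qed

text \<open>The factor \<open>1 / (4 * sqrt 3 * n)\<close> costs only a logarithm, which is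
  negligible against \<open>sqrt n\<close>. Having this for every \<open>\<eta> < 1\<close> is what
  preserves the leading constant in (c).\<close>

lemma ln_HR_ge:
  assumes "\<eta> < (1::real)"
  shows "\<forall>\<^sub>F n in sequentially. \<eta> * (pi * sqrt (2 * real n / 3)) \<le> ln (HR n)"
proof -
  have "(\<lambda>n. ln (4 * sqrt 3 * real n) / sqrt (real n)) \<longlonglongrightarrow> 0"
    by real_asymp
  moreover have "0 < (1 - \<eta>) * (pi * sqrt (2 / 3))" using assms by simp
  ultimately have "\<forall>\<^sub>F n in sequentially.
      ln (4 * sqrt 3 * real n) / sqrt (real n) < (1 - \<eta>) * (pi * sqrt (2 / 3))"
    by (rule order_tendstoD(2))
  thus ?thesis
    using eventually_gt_at_top[of 0]
  proof eventually_elim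
    case (elim n)
    have "ln (4 * sqrt 3 * real n) < (1 - \<eta>) * (pi * sqrt (2 / 3)) * sqrt (real n)"
      using elim by (simp add: field_simps)
    also have "\<dots> = (1 - \<eta>) * (pi * sqrt (2 * real n / 3))"
      by (simp add: real_sqrt_mult real_sqrt_divide)
    finally show ?case
      using elim by (simp add: HR_def ln_mult ln_div algebra_simps)
  qed
qed

text \<open>A crude bound, from \<open>pi < 4\<close>; it serves the lower bound on
  \<open>last_close\<close>, where constants do not matter.\<close>

lemma two_HR_le: 
  assumes "n \<ge> 1" shows "2 * HR n \<le> exp (4 * sqrt (real n))"
proof -
  have "sqrt (2 * real n / 3) \<le> sqrt (real n)" by simp
  hence "pi * sqrt (2 * real n / 3) \<le> 4 * sqrt (real n)"
    using pi_less_4 by (intro mult_mono) auto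
  hence *: "exp (pi * sqrt (2 * real n / 3)) \<le> exp (4 * sqrt (real n))" by simp
  have "1 \<le> sqrt 3" by simp
  hence "1 * 1 \<le> sqrt 3 * real n" using assms by (intro mult_mono) auto
  hence "2 / (4 * sqrt 3 * real n) \<le> 1" by (simp add: field_simps)
  hence "2 / (4 * sqrt 3 * real n) * exp (pi * sqrt (2 * real n / 3)) \<le> 1 * exp (4 * sqrt (real n))"
    using * by (intro mult_mono) auto
  thus ?thesis by (simp add: HR_def)
qed

section \<open>Counting integers close to powers\<close>

text \<open>With \<open>a\<close> and \<open>b\<close> the extreme bases, there are at most
  \<open>b - a + 1\<close> of them, and \<open>b^k - a^k \<ge> (b - a) * a^(k-1)\<close>, where
  \<open>a^(k-1)\<close> is at least \<open>u\<close> to the power \<open>(k-1)/k\<close>.\<close>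

lemma card_powers_between:
  fixes u v :: real and k :: nat
  assumes "k \<ge> 1" "u > 0" "u \<le> v"
  defines "V \<equiv> {m::nat. u \<le> real (m ^ k) \<and> real (m ^ k) \<le> v}"
  shows "finite V \<and> real (card V) \<le> 1 + (v - u) / u powr ((real k - 1) / real k)"
proof
  have "V \<subseteq> {..nat \<lfloor>v\<rfloor>}"
  proof
    fix m assume m: "m \<in> V"
    have "m \<le> m ^ k"
      using assms(1) by (cases "m = 0") (auto intro: self_le_power)
    hence "real m \<le> v" using m unfolding V_def
      by (metis (mono_tags, lifting) mem_Collect_eq of_nat_le_iff order_trans)
    thus "m \<in> {..nat \<lfloor>v\<rfloor>}" by (simp add: le_nat_floor)
  qed
  thus fin: "finite V" using finite_subset by blast
  show "real (card V) \<le> 1 + (v - u) / u powr ((real k - 1) / real k)"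
  proof (cases "V = {}")
    case True
    thus ?thesis using assms(1-3) by simp
  next
    case False
    define a b where "a = Min V" and "b = Max V"
    have a: "u \<le> real (a ^ k)" and b: "real (b ^ k) \<le> v"
      using Min_in[OF fin False] Max_in[OF fin False] by (auto simp: a_def b_def V_def)
    have ab: "a \<le> b" using fin False by (simp add: a_def b_def)
    have "V \<subseteq> {a..b}" using fin by (auto simp: a_def b_def)
    hence "card V \<le> b - a + 1" using card_mono[of "{a..b}" V] ab by simp
    hence card: "real (card V) \<le> 1 + (real b - real a)" using ab by linarith
    obtain j where k: "k = Suc j" using assms(1) by (cases k) auto
    have apos: "a > 0" using a assms(2) k by (cases "a = 0") auto
    have "u powr ((real k - 1) / real k) \<le> real (a ^ k) powr ((real k - 1) / real k)"
      using a assms by (intro powr_mono2) auto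
    also have "\<dots> = (real a powr real k) powr ((real k - 1) / real k)"
      using apos by (simp add: powr_realpow)
    also have "\<dots> = real a powr real j"
      using k by (subst powr_powr) simp
    also have "\<dots> = real a ^ j" using apos by (simp add: powr_realpow)
    finally have U: "u powr ((real k - 1) / real k) \<le> real a ^ j" .
    have "(real b - real a) * u powr ((real k - 1) / real k) \<le> (real b - real a) * real a ^ j"
      using U ab by (intro mult_left_mono) auto
    \<comment> \<open>Only the factor multiplying \<open>b\<close> is enlarged, from
      \<open>a^j\<close> to \<open>b^j\<close>.\<close>
    also have "\<dots> \<le> real b * real b ^ j - real a * real a ^ j"
      using mult_left_mono[OF power_mono[of "real a" "real b" j], of "real b"] ab
      by (simp add: left_diff_distrib)
    also have "\<dots> \<le> v - u" using a b k by simp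
    finally have "real b - real a \<le> (v - u) / u powr ((real k - 1) / real k)"
      using assms(2) by (simp add: pos_le_divide_eq)
    thus ?thesis using card by simp
  qed
qed

lemma card_nat_near:
  fixes c D :: real
  assumes "D \<ge> 0"
  shows "finite {x::nat. \<bar>real x - c\<bar> \<le> D} \<and> real (card {x::nat. \<bar>real x - c\<bar> \<le> D}) \<le> 2 * D + 1"
proof -
  let ?S = "{x::nat. \<bar>real x - c\<bar> \<le> D}"
  have sub: "int ` ?S \<subseteq> {\<lceil>c - D\<rceil>..\<lfloor>c + D\<rfloor>}"
    by (auto simp: ceiling_le_iff le_floor_iff abs_le_iff)
  hence fin: "finite ?S"
    by (intro finite_imageD[OF finite_subset[OF sub]]) auto
  have "card ?S = card (int ` ?S)" by (simp add: card_image)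
  also have "\<dots> \<le> nat (\<lfloor>c + D\<rfloor> - \<lceil>c - D\<rceil> + 1)"
    using card_mono[OF _ sub] by simp
  finally have "card ?S \<le> nat (\<lfloor>c + D\<rfloor> - \<lceil>c - D\<rceil> + 1)" .
  hence "real (card ?S) \<le> max 0 (real_of_int (\<lfloor>c + D\<rfloor> - \<lceil>c - D\<rceil> + 1))"
    by linarith
  also have "\<dots> \<le> 2 * D + 1"
    using assms of_int_floor_le[of "c + D"] le_of_int_ceiling[of "c - D"] by (simp; linarith)
  finally show ?thesis using fin by blast
qed

lemma power_dist_attained:
  obtains m :: int where "power_dist k x = nat \<bar>int x - m ^ k\<bar>"
  using Inf_nat_def1[of "range (\<lambda>m::int. nat \<bar>int x - m ^ k\<bar>)"]
  unfolding power_dist_def by auto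

lemma power_dist_le: "power_dist k x \<le> nat \<bar>int x - m ^ k\<bar>"
  unfolding power_dist_def by (rule cINF_lower) auto

text \<open>The nearest power may come from a negative base, but \<open>D < x\<close> forces that
  power to be positive, so the absolute value of the base has the same power.\<close>

lemma power_dist_le_nat_power:
  assumes "real (power_dist k x) \<le> D" "D < real x"
  obtains m :: nat where "\<bar>real x - real (m ^ k)\<bar> \<le> D"
proof -
  obtain m where m: "power_dist k x = nat \<bar>int x - m ^ k\<bar>"
    by (rule power_dist_attained)
  have D: "real_of_int \<bar>int x - m ^ k\<bar> \<le> D" using assms(1) m by simp
  have "real_of_int (int x - m ^ k) \<le> D" using D by linarith
  hence "real_of_int (m ^ k) > 0" using assms(2) by simp
  hence "m ^ k > 0" by linarith
  hence "int (nat \<bar>m\<bar> ^ k) = m ^ k" by (simp flip: power_abs)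
  hence "real (nat \<bar>m\<bar> ^ k) = real_of_int (m ^ k)" by (metis of_int_of_nat_eq)
  hence "\<bar>real x - real (nat \<bar>m\<bar> ^ k)\<bar> \<le> D" using D by simp
  thus ?thesis by (rule that)
qed

lemma finite_near_set: "finite (near_set \<epsilon> n)"
proof (rule finite_subset)
  show "near_set \<epsilon> n \<subseteq> {..nat \<lfloor>HR n * (1 + \<epsilon> n)\<rfloor>}"
    by (auto simp: near_set_def le_nat_floor)
qed simp

text \<open>The interval has length \<open>2 * HR n * \<epsilon> n\<close>, hence contains at least
  that many integers minus one; the assumption \<open>HR n * \<epsilon> n \<ge> 1\<close> absorbs
  the loss.\<close>

lemma card_near_set_ge:
  assumes "HR n * \<epsilon> n \<ge> 1" "\<epsilon> n < 1" "n \<ge> 1"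
  shows "real (card (near_set \<epsilon> n)) \<ge> HR n * \<epsilon> n"
proof -
  let ?a = "HR n * (1 - \<epsilon> n)" and ?b = "HR n * (1 + \<epsilon> n)"
  have a: "?a > 0" using HR_pos assms by simp
  have sub: "{nat \<lceil>?a\<rceil>..nat \<lfloor>?b\<rfloor>} \<subseteq> near_set \<epsilon> n"
  proof
    fix x assume "x \<in> {nat \<lceil>?a\<rceil>..nat \<lfloor>?b\<rfloor>}"
    hence x: "nat \<lceil>?a\<rceil> \<le> x" "x \<le> nat \<lfloor>?b\<rfloor>" by auto
    have ax: "?a \<le> real x" using x(1) by linarith
    \<comment> \<open>Besides membership, this is needed to undo \<open>nat\<close> in the upper
      bound: for \<open>x = 0\<close> the inequality \<open>x \<le> nat z\<close> says nothing about
      the sign of \<open>z\<close>.\<close>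
    hence "x \<noteq> 0" using a by (intro notI) simp
    moreover have "real x \<le> ?b"
    proof -
      have "int x \<le> \<lfloor>?b\<rfloor>" using x(2) \<open>x \<noteq> 0\<close> by linarith
      thus ?thesis by linarith
    qed
    ultimately show "x \<in> near_set \<epsilon> n" using ax by (simp add: near_set_def)
  qed
  have "HR n * \<epsilon> n \<le> ?b - ?a - 1" using assms(1) by (simp add: algebra_simps)
  also have "\<dots> \<le> real_of_int (\<lfloor>?b\<rfloor> + 1 - \<lceil>?a\<rceil>)" by linarith
  also have "\<dots> \<le> real (card {nat \<lceil>?a\<rceil>..nat \<lfloor>?b\<rfloor>})"
    using a by (simp; linarith)
  also have "\<dots> \<le> real (card (near_set \<epsilon> n))"
    using card_mono[OF finite_near_set sub] by simp
  finally show ?thesis .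
qed

text \<open>Every counted \<open>x\<close> lies in a window of radius \<open>D\<close> around a
  power, and that power lies in the interval \<open>[u, v]\<close> obtained by widening the near set
  by \<open>D\<close>. The factors bound the size of a window and the number of windows.\<close>

lemma card_near_power_le:
  assumes n: "n \<ge> 1" and k: "k \<ge> 2" and \<epsilon>: "0 < \<epsilon> n" "\<epsilon> n \<le> 1 / 4" and A: "HR n \<ge> 16"
    and D: "0 \<le> D" "D \<le> sqrt (HR n)"
  defines "s \<equiv> (real k - 1) / real k"
  shows "real (card {x \<in> near_set \<epsilon> n. real (power_dist k x) \<le> D})
           \<le> (2 * D + 1) * (5 + 4 * (HR n * \<epsilon> n) / HR n powr s)"
proof -
  define u v where "u = HR n * (1 - \<epsilon> n) - D" and "v = HR n * (1 + \<epsilon> n) + D"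
  define V where "V = {m::nat. u \<le> real (m ^ k) \<and> real (m ^ k) \<le> v}"
  have s: "1 / 2 \<le> s" "s \<le> 1" using k by (auto simp: s_def field_simps)
  have D4: "D \<le> HR n / 4" using D sqrt_le_quarter[OF A] by linarith
  have "HR n * \<epsilon> n \<le> HR n * (1/4)" using \<epsilon> A by (intro mult_left_mono) auto
  hence u2: "u \<ge> HR n / 2" using D4 by (simp add: u_def algebra_simps)
  have uv: "u \<le> v" using D \<epsilon> A by (simp add: u_def v_def algebra_simps)
  have As: "HR n powr s \<ge> sqrt (HR n)"
    using A s by (simp add: powr_half_sqrt[symmetric] powr_mono)
  hence As0: "HR n powr s > 0" using A by simp
  \<comment> \<open>Since \<open>s \<le> 1\<close>, replacing \<open>HR n\<close> by
    \<open>HR n / 2\<close> loses at most a factor 2 in the gap between powers.\<close>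
  have "2 powr s \<le> 2 powr (1::real)" using s by (intro powr_mono) auto
  hence "HR n powr s / 2 \<le> HR n powr s / 2 powr s"
    by (intro divide_left_mono) auto
  also have "\<dots> = (HR n / 2) powr s" using A by (simp add: powr_divide)
  also have "\<dots> \<le> u powr s" using u2 A s by (intro powr_mono2) auto
  finally have us: "HR n powr s / 2 \<le> u powr s" .
  have V: "finite V" "real (card V) \<le> 1 + (v - u) / u powr s"
    using card_powers_between[of k u v] k u2 A uv unfolding V_def s_def by auto
  have "(v - u) / u powr s \<le> (v - u) / (HR n powr s / 2)"
    using us As0 uv by (intro divide_left_mono mult_pos_pos) auto
  also have "\<dots> = 4 * (HR n * \<epsilon> n) / HR n powr s + 4 * (D / HR n powr s)"
    using As0 by (simp add: u_def v_def field_simps)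
  \<comment> \<open>Widening by \<open>D \<le> sqrt (HR n)\<close> is at most of the order of one
    gap, so it adds 4 to the leading 1; this gives the 5.\<close>
  also have "D / HR n powr s \<le> 1" using D As As0 by simp
  finally have cardV: "real (card V) \<le> 5 + 4 * (HR n * \<epsilon> n) / HR n powr s"
    using V(2) by simp
  have sub: "{x \<in> near_set \<epsilon> n. real (power_dist k x) \<le> D}
      \<subseteq> (\<Union>m\<in>V. {x. \<bar>real x - real (m ^ k)\<bar> \<le> D})"
  proof safe
    fix x assume x: "x \<in> near_set \<epsilon> n" and d: "real (power_dist k x) \<le> D"
    have bounds: "HR n * (1 - \<epsilon> n) \<le> real x" "real x \<le> HR n * (1 + \<epsilon> n)"
      using x by (auto simp: near_set_def)
    have "D < real x" using bounds(1) u2 A by (simp add: u_def)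
    then obtain m where m: "\<bar>real x - real (m ^ k)\<bar> \<le> D"
      using power_dist_le_nat_power d by blast
    have "m \<in> V" using m bounds unfolding V_def u_def v_def mem_Collect_eq by linarith
    thus "x \<in> (\<Union>m\<in>V. {x. \<bar>real x - real (m ^ k)\<bar> \<le> D})" using m by blast
  qed
  have fin: "finite (\<Union>m\<in>V. {x. \<bar>real x - real (m ^ k)\<bar> \<le> D})"
    using V(1) card_nat_near[OF D(1)] by blast
  have "real (card {x \<in> near_set \<epsilon> n. real (power_dist k x) \<le> D})
      \<le> real (card (\<Union>m\<in>V. {x. \<bar>real x - real (m ^ k)\<bar> \<le> D}))"
    using card_mono[OF fin sub] by simp
  also have "\<dots> \<le> (\<Sum>m\<in>V. real (card {x. \<bar>real x - real (m ^ k)\<bar> \<le> D}))"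
    using card_UN_le[OF V(1), of "\<lambda>m. {x. \<bar>real x - real (m ^ k)\<bar> \<le> D}"]
    by (simp flip: of_nat_sum)
  also have "\<dots> \<le> (\<Sum>m\<in>V. 2 * D + 1)"
    using card_nat_near[OF D(1)] by (intro sum_mono) blast
  also have "\<dots> = (2 * D + 1) * real (card V)" by simp
  also have "\<dots> \<le> (2 * D + 1) * (5 + 4 * (HR n * \<epsilon> n) / HR n powr s)"
    using cardV D by (intro mult_left_mono) auto
  finally show ?thesis .
qed

text \<open>The nearby power exceeds 1, so its base is at least 2 and
  \<open>2^k \<le> 2 * HR n\<close>. Hence only logarithmically many exponents enter a union
  bound.\<close>

lemma exponent_le_of_near_power:
  assumes \<epsilon>: "0 < \<epsilon> n" "\<epsilon> n \<le> 1 / 4" and A: "HR n \<ge> 16"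
    and D: "0 \<le> D" "D \<le> sqrt (HR n)"
    and x: "x \<in> near_set \<epsilon> n" "real (power_dist k x) \<le> D"
  shows "k \<le> nat \<lfloor>3 * ln (HR n)\<rfloor>"
proof -
  have D4: "D \<le> HR n / 4" using D sqrt_le_quarter[OF A] by linarith
  have "HR n * \<epsilon> n \<le> HR n * (1/4)" using \<epsilon> A by (intro mult_left_mono) auto
  hence bounds: "3/4 * HR n \<le> real x" "real x \<le> 5/4 * HR n"
    using x(1) by (auto simp: near_set_def algebra_simps)
  have "D < real x" using D4 bounds A by linarith
  then obtain m where m: "\<bar>real x - real (m ^ k)\<bar> \<le> D"
    using power_dist_le_nat_power x(2) by blast
  have big: "real (m ^ k) > 1" using m D4 bounds A by linarith
  have "m \<ge> 2"
  proof (rule ccontr)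
    assume "\<not> m \<ge> 2"
    hence "m = 0 \<or> m = 1" by auto
    hence "m ^ k \<le> 1" by (auto simp: power_0_left)
    thus False using big by linarith
  qed
  hence "(2::nat) ^ k \<le> m ^ k" by (intro power_mono) auto
  hence "real (2 ^ k) \<le> real (m ^ k)" by (simp only: of_nat_le_iff)
  also have "\<dots> \<le> 2 * HR n" using m D4 bounds by linarith
  finally have "2 ^ k \<le> 2 * HR n" by simp
  hence "ln (2 ^ k) \<le> ln (2 * HR n)" using A by (subst ln_le_cancel_iff) auto
  hence le: "real k * ln 2 \<le> ln 2 + ln (HR n)" using A by (simp add: ln_realpow ln_mult)
  \<comment> \<open>As \<open>HR n \<ge> 16\<close>, the summand \<open>ln 2\<close> is at most a
    quarter of \<open>ln (HR n)\<close>. With \<open>ln 2 \<ge> 1/2\<close> this yields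
    \<open>k \<le> 5/2 * ln (HR n)\<close>.\<close>
  have "ln (2 ^ 4) \<le> ln (HR n)" using A by (subst ln_le_cancel_iff) auto
  hence "4 * ln 2 \<le> ln (HR n)" by (subst (asm) ln_realpow) auto
  hence "real k * ln 2 \<le> 5/4 * ln (HR n)" using le by simp
  moreover have "real k * (1/2) \<le> real k * ln 2"
    using ln2_ge_two_thirds by (intro mult_left_mono) auto
  moreover have "0 \<le> ln (HR n)" using A by simp
  ultimately have "real k \<le> 3 * ln (HR n)" by linarith
  thus ?thesis by (simp add: le_nat_floor)
qed

section \<open>Uniform random variables on a finite set\<close>

text \<open>The value type is countable, so the null events \<open>X = m\<close> for
  \<open>m\<close> outside \<open>S\<close> have a null union. What remains of an event is a finite
  disjoint union of point events.\<close>

lemma (in prob_space)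
  fixes X :: "'a \<Rightarrow> 'b :: countable"
  assumes meas: "X \<in> measurable M (count_space UNIV)" and fin: "finite S"
    and unif: "\<And>m. \<P>(\<omega> in M. X \<omega> = m) = (if m \<in> S then 1 / real (card S) else 0)"
  shows AE_uniform: "AE \<omega> in M. X \<omega> \<in> S"
    and prob_uniform: "\<P>(\<omega> in M. X \<omega> \<in> T) = real (card {x \<in> S. x \<in> T}) / real (card S)"
proof -
  note [measurable] = meas
  have "AE \<omega> in M. X \<omega> \<noteq> m" if "m \<notin> S" for m
    using unif[of m] that by (subst prob_Collect_eq_0[symmetric]) auto
  hence "AE \<omega> in M. \<forall>m\<in>-S. X \<omega> \<noteq> m"
    by (subst AE_ball_countable) auto
  thus AE: "AE \<omega> in M. X \<omega> \<in> S" by eventually_elim auto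
  have "\<P>(\<omega> in M. X \<omega> \<in> T) = \<P>(\<omega> in M. X \<omega> \<in> S \<inter> T)"
    using AE by (intro measure_eq_AE) auto
  also have "{\<omega> \<in> space M. X \<omega> \<in> S \<inter> T} = (\<Union>m\<in>S \<inter> T. {\<omega> \<in> space M. X \<omega> = m})" by auto
  also have "measure M \<dots> = (\<Sum>m\<in>S \<inter> T. \<P>(\<omega> in M. X \<omega> = m))"
    using fin by (intro finite_measure_finite_Union) (auto simp: disjoint_family_on_def)
  also have "\<dots> = real (card {x \<in> S. x \<in> T}) / real (card S)"
    using unif by (simp add: Int_def)
  finally show "\<P>(\<omega> in M. X \<omega> \<in> T) = real (card {x \<in> S. x \<in> T}) / real (card S)" .
qed

section \<open>Bounds on \<open>last_close\<close> for a fixed realization\<close>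

lemma last_close_le:
  assumes "\<And>n. n \<ge> 1 \<Longrightarrow> n > B \<Longrightarrow> d < real (power_dist k (x n))"
  shows "last_close x k d \<le> enat B"
proof -
  define N where "N = {n. n \<ge> 1 \<and> real (power_dist k (x n)) \<le> d}"
  have N: "n \<le> B" if "n \<in> N" for n
    using assms[of n] that by (fastforce simp: N_def)
  hence fin: "finite N" using finite_nat_set_iff_bounded_le by blast
  hence "N \<noteq> {} \<Longrightarrow> Max N \<le> B" using N by simp
  thus ?thesis using fin unfolding last_close_def Let_def N_def[symmetric] by simp
qed

lemma le_last_close:
  assumes "n \<ge> 1" "real (power_dist k (x n)) \<le> d"
  shows "enat n \<le> last_close x k d"
proof -
  define N where "N = {n. n \<ge> 1 \<and> real (power_dist k (x n)) \<le> d}"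
  have "n \<in> N" using assms by (simp add: N_def)
  hence "N \<noteq> {}" "finite N \<Longrightarrow> n \<le> Max N" by auto
  thus ?thesis unfolding last_close_def Let_def N_def[symmetric] by simp
qed

text \<open>Write \<open>s = (k-1)/k\<close>. If \<open>n\<close> is large and the distance is at
  most \<open>d\<close>, then \<open>ln (HR n) < (2/s) * ln d\<close>. As \<open>ln (HR n)\<close>
  is asymptotic to \<open>pi * sqrt (2n/3)\<close>, solving for \<open>n\<close> gives the factor
  \<open>(2/s)^2 * 3 / (2 * pi^2)\<close>, up to an arbitrarily small loss.\<close>

lemma last_close_upper:
  fixes x :: "nat \<Rightarrow> nat" and k :: nat and e :: real
  assumes k: "k \<ge> 2" and e: "e > 0"
    and far: "\<forall>\<^sub>F n in sequentially.
                HR n powr ((real k - 1) / real k / 2) < real (power_dist k (x n))"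
  shows "\<forall>\<^sub>F d in at_top. ereal_of_enat (last_close x k d) <
           ereal ((4 + e) * (3 / (2 * pi\<^sup>2)) * (real k / (real k - 1))\<^sup>2 * (ln d)\<^sup>2)"
proof -
  define s where "s = (real k - 1) / real k"
  \<comment> \<open>The loss \<open>\<eta>^2\<close> in the exponent turns the constant 4 into
    \<open>4 + e/2\<close>. The remaining gap between \<open>C\<close> and \<open>C'\<close> makes
    the final inequality strict.\<close>
  define \<eta> where "\<eta> = sqrt (4 / (4 + e / 2))"
  define C where "C = (4 + e / 2) * (3 / (2 * pi\<^sup>2)) * (real k / (real k - 1))\<^sup>2"
  define C' where "C' = (4 + e) * (3 / (2 * pi\<^sup>2)) * (real k / (real k - 1))\<^sup>2"
  have s: "s > 0" using k by (simp add: s_def)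
  have \<eta>: "0 < \<eta>" "\<eta> < 1" "\<eta>\<^sup>2 = 4 / (4 + e / 2)" using e by (simp_all add: \<eta>_def)
  have CC: "C < C'" using e k by (simp add: C_def C'_def divide_strict_right_mono)
  have Cpos: "C > 0" using e k by (simp add: C_def)
  have Cs: "C * (s\<^sup>2 * (\<eta>\<^sup>2 * pi\<^sup>2)) = 6"
    using e k by (simp add: C_def s_def \<eta>(3) power_divide) (simp add: divide_simps)
  have "\<forall>\<^sub>F n in sequentially. n \<ge> 1 \<and> HR n powr (s / 2) < real (power_dist k (x n)) \<and>
          \<eta> * (pi * sqrt (2 * real n / 3)) \<le> ln (HR n)"
    using far ln_HR_ge[OF \<eta>(2)] eventually_ge_at_top[of 1]
    unfolding s_def by eventually_elim simp
  then obtain N where N: "n \<ge> 1" "HR n powr (s / 2) < real (power_dist k (x n))"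
      "\<eta> * (pi * sqrt (2 * real n / 3)) \<le> ln (HR n)" if "n \<ge> N" for n
    unfolding eventually_sequentially by blast
  have le: "last_close x k d \<le> enat (max N (nat \<lfloor>C * (ln d)\<^sup>2\<rfloor>))" for d
  proof (rule last_close_le, rule ccontr)
    fix n assume n: "n \<ge> 1" "n > max N (nat \<lfloor>C * (ln d)\<^sup>2\<rfloor>)"
      and "\<not> d < real (power_dist k (x n))"
    hence "HR n powr (s / 2) < d" using N(2)[of n] by simp
    moreover have "HR n powr (s / 2) > 0" using HR_pos[OF n(1)] by simp
    ultimately have "ln (HR n powr (s / 2)) < ln d" by (subst ln_less_cancel_iff) linarith+
    hence "s / 2 * ln (HR n) < ln d" using HR_pos[OF n(1)] by (simp add: ln_powr)
    moreover have "s / 2 * (\<eta> * (pi * sqrt (2 * real n / 3))) \<le> s / 2 * ln (HR n)"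
      using N(3)[of n] n s by (intro mult_left_mono) auto
    ultimately have "s / 2 * (\<eta> * (pi * sqrt (2 * real n / 3))) < ln d" by linarith
    hence "(s / 2 * (\<eta> * (pi * sqrt (2 * real n / 3))))\<^sup>2 < (ln d)\<^sup>2"
      using s \<eta> by (intro power_strict_mono) auto
    \<comment> \<open>The 6 comes from \<open>(1/2)^2 * (2/3)\<close>; \<open>C\<close> was chosen
      to cancel the whole coefficient.\<close>
    hence "s\<^sup>2 * (\<eta>\<^sup>2 * pi\<^sup>2) * real n / 6 < (ln d)\<^sup>2"
      by (simp add: power_mult_distrib power_divide mult_ac)
    hence "C * (s\<^sup>2 * (\<eta>\<^sup>2 * pi\<^sup>2) * real n / 6) < C * (ln d)\<^sup>2"
      using Cpos by (intro mult_strict_left_mono)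
    also have "C * (s\<^sup>2 * (\<eta>\<^sup>2 * pi\<^sup>2) * real n / 6)
        = C * (s\<^sup>2 * (\<eta>\<^sup>2 * pi\<^sup>2)) * real n / 6" by (simp only: mult.assoc times_divide_eq_right)
    also have "\<dots> = real n" unfolding Cs by simp
    finally have "real n < C * (ln d)\<^sup>2" .
    moreover have "nat \<lfloor>C * (ln d)\<^sup>2\<rfloor> < n" using n by simp
    ultimately show False by linarith
  qed
  have "filterlim (\<lambda>d. C' * (ln d)\<^sup>2) at_top (at_top :: real filter)"
    using Cpos CC by real_asymp
  hence "\<forall>\<^sub>F d in at_top. real N < C' * (ln d)\<^sup>2"
    by (simp add: filterlim_at_top_dense)
  thus ?thesis
    using eventually_gt_at_top[of 1]
  proof eventually_elim
    case (elim d)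
    have "C * (ln d)\<^sup>2 < C' * (ln d)\<^sup>2" using CC elim by simp
    moreover have "C * (ln d)\<^sup>2 \<ge> 0" using Cpos by simp
    ultimately have "real (max N (nat \<lfloor>C * (ln d)\<^sup>2\<rfloor>)) < C' * (ln d)\<^sup>2"
      using elim by (simp; linarith)
    moreover have "ereal_of_enat (last_close x k d)
        \<le> ereal_of_enat (enat (max N (nat \<lfloor>C * (ln d)\<^sup>2\<rfloor>)))"
      using le[of d] by (simp only: ereal_of_enat_le_iff)
    ultimately show ?case unfolding C'_def[symmetric]
      by (metis ereal_of_enat_simps(1) ereal_less(1) less_ereal.simps(1) order_le_less_trans)
  qed
qed

lemma power_dist_le_self: "k \<ge> 1 \<Longrightarrow> power_dist k x \<le> x"
  using power_dist_le[of k x 0] by (simp add: power_0_left)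

text \<open>The upper bound is \<open>last_close_upper\<close> with \<open>e = 1\<close>. For the
  lower bound the power 0 suffices: the distance is at most \<open>x n\<close>, which stays below
  \<open>d\<close> as long as \<open>exp (4 * sqrt n) \<le> d\<close>.\<close>

lemma last_close_bigtheta:
  fixes x :: "nat \<Rightarrow> nat" and k :: nat
  assumes k: "k \<ge> 2"
    and far: "\<forall>\<^sub>F n in sequentially.
                HR n powr ((real k - 1) / real k / 2) < real (power_dist k (x n))"
    and le: "\<forall>\<^sub>F n in sequentially. real (x n) \<le> 2 * HR n"
  shows "(\<lambda>d. real (the_enat (last_close x k d))) \<in> \<Theta>(\<lambda>d. (ln d)\<^sup>2)"
proof (rule bigthetaI)
  define C where "C = (4 + 1) * (3 / (2 * pi\<^sup>2)) * (real k / (real k - 1))\<^sup>2"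
  have "\<forall>\<^sub>F d in at_top. ereal_of_enat (last_close x k d) < ereal (C * (ln d)\<^sup>2)"
    using last_close_upper[OF k _ far, of 1] by (simp add: C_def)
  hence fin: "\<forall>\<^sub>F d in at_top. last_close x k d \<noteq> \<infinity> \<and>
      real (the_enat (last_close x k d)) \<le> C * (ln d)\<^sup>2"
  proof eventually_elim
    case (elim d)
    thus ?case by (cases "last_close x k d") auto
  qed
  show "(\<lambda>d. real (the_enat (last_close x k d))) \<in> O(\<lambda>d. (ln d)\<^sup>2)"
    using fin by (intro bigoI[of _ C]) (auto elim!: eventually_mono)
  obtain N where N: "real (x n) \<le> 2 * HR n" if "n \<ge> N" for n
    using le unfolding eventually_sequentially by blast
  have "\<forall>\<^sub>F d in at_top. (ln d)\<^sup>2 / 16 \<ge> real N + 2 \<and> d > (1::real)"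
    by (intro eventually_conj; real_asymp)
  with fin have "\<forall>\<^sub>F d in at_top. (ln d)\<^sup>2 \<le> 32 * real (the_enat (last_close x k d))"
  proof eventually_elim
    case (elim d)
    \<comment> \<open>Up to rounding, the largest \<open>n\<close> with
      \<open>4 * sqrt n \<le> ln d\<close>. The margin \<open>N + 2\<close> gives
      \<open>n \<ge> N\<close> and \<open>n \<ge> 1\<close>; then \<open>n + 1 \<le> 2 * n\<close>
      turns 16 into 32.\<close>
    define n where "n = nat \<lfloor>(ln d)\<^sup>2 / 16\<rfloor>"
    have "(ln d)\<^sup>2 / 16 \<ge> 0" by simp
    hence n: "real n \<le> (ln d)\<^sup>2 / 16" "(ln d)\<^sup>2 / 16 < real n + 1"
      unfolding n_def by linarith+
    hence "n \<ge> N" "n \<ge> 1" using elim by linarith+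
    have "real (power_dist k (x n)) \<le> real (x n)"
      using power_dist_le_self[of k "x n"] k by simp
    also have "\<dots> \<le> exp (4 * sqrt (real n))"
      using N[OF \<open>n \<ge> N\<close>] two_HR_le[OF \<open>n \<ge> 1\<close>] by linarith
    also have "sqrt (real n) \<le> ln d / 4"
      using n(1) elim by (intro real_le_lsqrt) (auto simp: power_divide)
    hence "exp (4 * sqrt (real n)) \<le> exp (ln d)" by simp
    also have "\<dots> = d" using elim by simp
    finally have "enat n \<le> last_close x k d" using \<open>n \<ge> 1\<close> le_last_close by blast
    hence "n \<le> the_enat (last_close x k d)" using elim by auto
    hence "real n \<le> real (the_enat (last_close x k d))" by simp
    thus ?case using n elim by linarith
  qed
  thus "(\<lambda>d. real (the_enat (last_close x k d))) \<in> \<Omega>(\<lambda>d. (ln d)\<^sup>2)"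
    by (intro landau_omega.bigI[of "1/32"]) (auto elim!: eventually_mono)
qed

section \<open>Almost sure distance bounds by Borel-Cantelli\<close>

locale uniform_near_HR = prob_space M for M :: "'a measure" +
  fixes p :: "nat \<Rightarrow> 'a \<Rightarrow> nat" and \<epsilon> :: "nat \<Rightarrow> real"
  assumes eps_pos: "\<And>n. n \<ge> 1 \<Longrightarrow> \<epsilon> n > 0"
    and eps_lim: "\<epsilon> \<longlonglongrightarrow> 0"
    and eps_big: "\<epsilon> \<in> \<Omega>(\<lambda>n. ln (HR n) / sqrt (HR n))"
    and meas: "\<And>n. n \<ge> 1 \<Longrightarrow> p n \<in> measurable M (count_space UNIV)"
    and unif: "\<And>n m. n \<ge> 1 \<Longrightarrow> \<P>(\<omega> in M. p n \<omega> = m) =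
           (if m \<in> near_set \<epsilon> n then 1 / real (card (near_set \<epsilon> n)) else 0)"
begin

lemma AE_in_near_set: "AE \<omega> in M. \<forall>n\<ge>1. p n \<omega> \<in> near_set \<epsilon> n"
proof -
  have "AE \<omega> in M. \<forall>n\<in>{1..}. p n \<omega> \<in> near_set \<epsilon> n"
    using AE_uniform[OF meas finite_near_set unif] by (subst AE_ball_countable) auto
  thus ?thesis by eventually_elim simp
qed

text \<open>The convergence half of Borel-Cantelli, with probabilities expressed as ratios of
  cardinalities; it requires only the individual laws of the \<open>p n\<close>.\<close>

lemma AE_eventually_notin:
  assumes le: "\<forall>\<^sub>F n in sequentially.
      real (card {x \<in> near_set \<epsilon> n. x \<in> T n}) / real (card (near_set \<epsilon> n)) \<le> g n"
    and g: "summable g"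
  shows "AE \<omega> in M. \<forall>\<^sub>F n in sequentially. p n \<omega> \<notin> T n"
proof -
  \<comment> \<open>The conjunct \<open>n \<ge> 1\<close> makes \<open>E 0\<close> empty, since
    nothing is known about \<open>p 0\<close>.\<close>
  define E where "E n = {\<omega> \<in> space M. n \<ge> 1 \<and> p n \<omega> \<in> T n}" for n
  have E: "E n \<in> sets M" for n
  proof (cases "n \<ge> 1")
    case True
    note [measurable] = meas[OF True]
    show ?thesis unfolding E_def by measurable
  qed (simp add: E_def)
  have "\<forall>\<^sub>F n in sequentially. norm (measure M (E n)) \<le> g n"
    using le eventually_ge_at_top[of 1]
  proof eventually_elim
    case (elim n)
    thus ?case using prob_uniform[OF meas finite_near_set unif, of n "T n"] by (simp add: E_def)
  qed
  hence "summable (\<lambda>n. measure M (E n))" using g by (rule summable_comparison_test_ev)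
  hence "AE \<omega> in M. \<forall>\<^sub>F n in sequentially. \<omega> \<in> space M - E n"
    using E by (intro borel_cantelli_AE1) (auto simp: emeasure_eq_measure)
  thus ?thesis
  proof eventually_elim
    case (elim \<omega>)
    from elim eventually_ge_at_top[of 1] show ?case
      by eventually_elim (auto simp: E_def)
  qed
qed

text \<open>The lower bound on \<open>\<epsilon>\<close> makes \<open>HR n * \<epsilon> n\<close> at
  least a constant times \<open>ln (HR n) * sqrt (HR n)\<close>, which tends to infinity.\<close>

lemma eventually_regular:
  "\<forall>\<^sub>F n in sequentially. n \<ge> 1 \<and> \<epsilon> n \<le> 1 / 4 \<and> HR n \<ge> 16 \<and> HR n * \<epsilon> n \<ge> 1"
proof -
  from eps_big obtain c where c: "c > 0"
    "\<forall>\<^sub>F n in sequentially. norm (\<epsilon> n) \<ge> c * norm (ln (HR n) / sqrt (HR n))"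
    by (elim landau_omega.bigE)
  have "filterlim (\<lambda>n. c * (ln (HR n) * sqrt (HR n))) at_top sequentially"
    by (intro filterlim_tendsto_pos_mult_at_top[OF tendsto_const c(1)]
          filterlim_at_top_mult_at_top filterlim_compose[OF ln_at_top HR_at_top]
          filterlim_compose[OF sqrt_at_top HR_at_top])
  hence ev1: "\<forall>\<^sub>F n in sequentially. 1 \<le> c * (ln (HR n) * sqrt (HR n))"
    by (simp add: filterlim_at_top)
  have ev2: "\<forall>\<^sub>F n in sequentially. 16 \<le> HR n"
    using HR_at_top by (simp add: filterlim_at_top)
  have ev3: "\<forall>\<^sub>F n in sequentially. \<epsilon> n < 1 / 4"
    using order_tendstoD(2)[OF eps_lim, of "1/4"] by simp
  show ?thesis
    using ev1 ev2 ev3 c(2) eventually_ge_at_top[of 1]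
  proof eventually_elim
    case (elim n)
    have "c * (ln (HR n) / sqrt (HR n)) \<le> \<epsilon> n"
      using elim eps_pos[of n] by simp
    hence "HR n * (c * (ln (HR n) / sqrt (HR n))) \<le> HR n * \<epsilon> n"
      using elim by (intro mult_left_mono) auto
    also have "HR n * (c * (ln (HR n) / sqrt (HR n))) = c * (ln (HR n) * sqrt (HR n))"
      using elim by (simp add: field_simps)
    finally show ?case using elim by simp
  qed
qed

lemma near_power_fraction_le:
  assumes n: "n \<ge> 1" "\<epsilon> n \<le> 1 / 4" "HR n \<ge> 16" "HR n * \<epsilon> n \<ge> 1"
    and k: "k \<ge> 2" and D: "0 \<le> D" "D \<le> sqrt (HR n)"
  shows "real (card {x \<in> near_set \<epsilon> n. real (power_dist k x) \<le> D}) / real (card (near_set \<epsilon> n))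
      \<le> (2 * D + 1) * (5 / (HR n * \<epsilon> n) + 4 / HR n powr ((real k - 1) / real k))"
proof -
  have "real (card {x \<in> near_set \<epsilon> n. real (power_dist k x) \<le> D}) / real (card (near_set \<epsilon> n))
      \<le> (2 * D + 1) * (5 + 4 * (HR n * \<epsilon> n) / HR n powr ((real k - 1) / real k)) / (HR n * \<epsilon> n)"
    using card_near_power_le[of n k \<epsilon> D] card_near_set_ge[of n \<epsilon>] eps_pos[of n] n k D
    by (intro frac_le) auto
  also have "\<dots> = (2 * D + 1) * (5 / (HR n * \<epsilon> n) + 4 / HR n powr ((real k - 1) / real k))"
    using n eps_pos[of n] by (simp add: field_simps)
  finally show ?thesis .
qed

text \<open>A union bound over the exponents \<open>2..K\<close>, so that the threshold for
  \<open>n\<close> serves all \<open>k\<close> simultaneously.\<close>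

lemma AE_eventually_far_from_powers:
  assumes d: "d \<ge> 0"
  shows "AE \<omega> in M. \<forall>\<^sub>F n in sequentially. \<forall>k\<ge>2. d < real (power_dist k (p n \<omega>))"
proof -
  from eps_big obtain c where c: "c > 0"
    "\<forall>\<^sub>F n in sequentially. norm (\<epsilon> n) \<ge> c * norm (ln (HR n) / sqrt (HR n))"
    by (elim landau_omega.bigE)
  define T where "T = {x. \<exists>k\<ge>2. real (power_dist k x) \<le> d}"
  \<comment> \<open>The number of exponents is at most \<open>3 * ln (HR n)\<close>. Multiplied by
    it, \<open>1 / (HR n * \<epsilon> n)\<close> becomes at most
    \<open>3 / (c * sqrt (HR n))\<close>, and the gap term becomes the summable
    \<open>ln (HR n) / sqrt (HR n)\<close>.\<close>
  define g where "g n = 3 * (2 * d + 1) *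
      (5 / c * HR n powr (-(1/2)) + 4 * (ln (HR n) / sqrt (HR n)))" for n
  have sg: "summable g"
    unfolding g_def by (intro summable_mult summable_add summable_HR_powr summable_ln_HR_div_sqrt) simp
  have ev: "\<forall>\<^sub>F n in sequentially. d \<le> sqrt (HR n)"
    using filterlim_compose[OF sqrt_at_top HR_at_top] by (simp add: filterlim_at_top)
  have "\<forall>\<^sub>F n in sequentially.
      real (card {x \<in> near_set \<epsilon> n. x \<in> T}) / real (card (near_set \<epsilon> n)) \<le> g n"
    using eventually_regular ev c(2)
  proof eventually_elim
    case (elim n)
    hence n: "n \<ge> 1" "\<epsilon> n \<le> 1 / 4" "HR n \<ge> 16" "HR n * \<epsilon> n \<ge> 1" "d \<le> sqrt (HR n)" by auto
    define K where "K = nat \<lfloor>3 * ln (HR n)\<rfloor>"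
    define S where "S k = {x \<in> near_set \<epsilon> n. real (power_dist k x) \<le> d}" for k
    have finS: "finite (S k)" for k using finite_near_set by (simp add: S_def)
    have lnA: "ln (HR n) \<ge> 0" using n by simp
    have "{x \<in> near_set \<epsilon> n. x \<in> T} \<subseteq> (\<Union>k\<in>{2..K}. S k)"
    proof safe
      fix x assume x: "x \<in> near_set \<epsilon> n" "x \<in> T"
      then obtain k where k: "k \<ge> 2" "real (power_dist k x) \<le> d" unfolding T_def by blast
      hence "k \<le> K" unfolding K_def
        using exponent_le_of_near_power[of \<epsilon> n d x k] eps_pos[of n] n d x by simp
      thus "x \<in> (\<Union>k\<in>{2..K}. S k)" using x k by (auto simp: S_def)
    qed
    hence "card {x \<in> near_set \<epsilon> n. x \<in> T} \<le> card (\<Union>k\<in>{2..K}. S k)"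
      using finS by (intro card_mono) auto
    also have "\<dots> \<le> (\<Sum>k\<in>{2..K}. card (S k))" by (intro card_UN_le) simp
    finally have "real (card {x \<in> near_set \<epsilon> n. x \<in> T}) \<le> (\<Sum>k\<in>{2..K}. real (card (S k)))"
      by (simp flip: of_nat_sum)
    hence "real (card {x \<in> near_set \<epsilon> n. x \<in> T}) / real (card (near_set \<epsilon> n))
        \<le> (\<Sum>k\<in>{2..K}. real (card (S k)) / real (card (near_set \<epsilon> n)))"
      by (simp add: divide_right_mono flip: sum_divide_distrib)
    also have "\<dots> \<le> (\<Sum>k\<in>{2..K}. (2 * d + 1) * (5 / (HR n * \<epsilon> n) + 4 / sqrt (HR n)))"
    proof (rule sum_mono)
      fix k assume "k \<in> {2..K}"
      hence k: "k \<ge> 2" by simp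
      \<comment> \<open>Squares are the densest powers, so \<open>k = 2\<close> is the worst
        case.\<close>
      have "1 / 2 \<le> (real k - 1) / real k" using k by (simp add: field_simps)
      hence "sqrt (HR n) \<le> HR n powr ((real k - 1) / real k)"
        using n by (simp add: powr_half_sqrt[symmetric] powr_mono)
      hence "4 / HR n powr ((real k - 1) / real k) \<le> 4 / sqrt (HR n)"
        using n by (intro divide_left_mono) auto
      hence "(2 * d + 1) * (5 / (HR n * \<epsilon> n) + 4 / HR n powr ((real k - 1) / real k))
          \<le> (2 * d + 1) * (5 / (HR n * \<epsilon> n) + 4 / sqrt (HR n))"
        using d by (intro mult_left_mono) auto
      thus "real (card (S k)) / real (card (near_set \<epsilon> n))
          \<le> (2 * d + 1) * (5 / (HR n * \<epsilon> n) + 4 / sqrt (HR n))"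
        using near_power_fraction_le[OF n(1-4) k d n(5)] unfolding S_def by linarith
    qed
    also have "\<dots> = real (K + 1 - 2) * ((2 * d + 1) * (5 / (HR n * \<epsilon> n) + 4 / sqrt (HR n)))"
      by simp
    also have "\<dots> \<le> (3 * ln (HR n)) * ((2 * d + 1) * (5 / (HR n * \<epsilon> n) + 4 / sqrt (HR n)))"
    proof (rule mult_right_mono)
      \<comment> \<open>The natural difference \<open>K + 1 - 2\<close> is at most \<open>K\<close>,
        also when it truncates to 0.\<close>
      have "real K \<le> 3 * ln (HR n)" using lnA unfolding K_def by simp
      thus "real (K + 1 - 2) \<le> 3 * ln (HR n)" by linarith
      show "0 \<le> (2 * d + 1) * (5 / (HR n * \<epsilon> n) + 4 / sqrt (HR n))" using d n by simp
    qed
    also have "\<dots> = 3 * (2 * d + 1) *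
        (5 * (ln (HR n) / (HR n * \<epsilon> n)) + 4 * (ln (HR n) / sqrt (HR n)))"
      by (simp add: algebra_simps)
    also have "\<dots> \<le> 3 * (2 * d + 1) *
        (5 * (1 / (c * sqrt (HR n))) + 4 * (ln (HR n) / sqrt (HR n)))"
    proof -
      have "c * (ln (HR n) / sqrt (HR n)) \<le> \<epsilon> n"
        using elim(3) eps_pos[of n] n by simp
      hence "(c * (ln (HR n) / sqrt (HR n))) * HR n \<le> \<epsilon> n * HR n"
        using n by (intro mult_right_mono) auto
      also have "(c * (ln (HR n) / sqrt (HR n))) * HR n = c * sqrt (HR n) * ln (HR n)"
        using n by (simp add: field_simps)
      finally have "ln (HR n) / (HR n * \<epsilon> n) \<le> 1 / (c * sqrt (HR n))"
        using n eps_pos[of n] c(1) by (simp add: field_simps)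
      thus ?thesis using d by (intro mult_left_mono add_right_mono) auto
    qed
    also have "\<dots> = g n"
    proof -
      have "HR n powr (-(1/2)) = inverse (sqrt (HR n))"
        using n by (subst powr_minus, subst powr_half_sqrt) auto
      moreover have "5 * (1 / (c * sqrt (HR n))) = 5 / c * inverse (sqrt (HR n))"
        by (simp add: field_simps)
      ultimately show ?thesis unfolding g_def by (simp only:)
    qed
    finally show ?case .
  qed
  from AE_eventually_notin[OF this sg] show ?thesis
    by eventually_elim (auto simp: T_def elim!: eventually_mono)
qed

text \<open>The extra assumption gives \<open>HR n * \<epsilon> n \<ge> c * D^2\<close> for the
  growing radius \<open>D = HR n powr (s / 2)\<close>. So both terms of the fraction bound are of
  order \<open>1 / D^2\<close>, and the window size \<open>2 * D + 1 \<le> 3 * D\<close> leaves the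
  summable order \<open>1 / D\<close>.\<close>

lemma AE_eventually_far_from_kth_powers:
  fixes k :: nat
  assumes k: "k \<ge> 2" and eps: "\<epsilon> \<in> \<Omega>(\<lambda>n. HR n powr (- 1 / real k))"
  shows "AE \<omega> in M. \<forall>\<^sub>F n in sequentially.
           HR n powr ((real k - 1) / real k / 2) < real (power_dist k (p n \<omega>))"
proof -
  define s where "s = (real k - 1) / real k"
  have s: "0 < s" "s \<le> 1" "1 + - 1 / real k = s" using k by (auto simp: s_def field_simps)
  from eps obtain c where c: "c > 0"
    "\<forall>\<^sub>F n in sequentially. norm (\<epsilon> n) \<ge> c * norm (HR n powr (- 1 / real k))"
    by (elim landau_omega.bigE)
  define T where "T n = {x. real (power_dist k x) \<le> HR n powr (s / 2)}" for n
  define g where "g n = 3 * (5 / c + 4) * HR n powr (-(s / 2))" for n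
  have sg: "summable g"
    unfolding g_def using s by (intro summable_mult summable_HR_powr) simp
  have "\<forall>\<^sub>F n in sequentially.
      real (card {x \<in> near_set \<epsilon> n. x \<in> T n}) / real (card (near_set \<epsilon> n)) \<le> g n"
    using eventually_regular c(2)
  proof eventually_elim
    case (elim n)
    hence n: "n \<ge> 1" "\<epsilon> n \<le> 1 / 4" "HR n \<ge> 16" "HR n * \<epsilon> n \<ge> 1" by auto
    define D where "D = HR n powr (s / 2)"
    have D: "1 \<le> D" "D \<le> sqrt (HR n)"
      using n s by (auto simp: D_def ge_one_powr_ge_zero powr_half_sqrt[symmetric] intro!: powr_mono)
    have DD: "HR n powr s = D * D" by (simp add: D_def flip: powr_add)
    have "c * HR n powr (- 1 / real k) \<le> \<epsilon> n" using elim eps_pos[of n] by simp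
    hence "HR n * (c * HR n powr (- 1 / real k)) \<le> HR n * \<epsilon> n"
      using n by (intro mult_left_mono) auto
    also have "HR n * (c * HR n powr (- 1 / real k)) = c * HR n powr (1 + - 1 / real k)"
      using n by (subst powr_add) simp
    also have "\<dots> = c * (D * D)" by (simp only: s DD)
    finally have cD: "c * (D * D) \<le> HR n * \<epsilon> n" .
    have "real (card {x \<in> near_set \<epsilon> n. x \<in> T n}) / real (card (near_set \<epsilon> n))
        \<le> (2 * D + 1) * (5 / (HR n * \<epsilon> n) + 4 / (D * D))"
      using near_power_fraction_le[OF n k, of D] D
      by (simp add: T_def s_def[symmetric] DD D_def[symmetric])
    also have "\<dots> \<le> (3 * D) * (5 / (c * (D * D)) + 4 / (D * D))"
    proof (intro mult_mono add_mono)
      show "5 / (HR n * \<epsilon> n) \<le> 5 / (c * (D * D))"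
        using D n cD c(1) by (intro divide_left_mono) auto
    qed (use D n in auto)
    also have "\<dots> = 3 * (5 / c + 4) * inverse D"
      using D c(1) by (simp add: field_simps)
    also have "\<dots> = g n" by (simp add: g_def D_def powr_minus)
    finally show ?case .
  qed
  from AE_eventually_notin[OF this sg] show ?thesis
    by (simp add: T_def s_def not_le)
qed

text \<open>Countably many natural radii suffice, as every real \<open>d\<close> lies below one of
  them. The bound \<open>B\<close> precedes the quantifier over \<open>k\<close>, as (d)
  requires.\<close>

lemma AE_all_far_from_powers:
  "AE \<omega> in M. \<forall>d. \<exists>B. \<forall>n>B. \<forall>k\<ge>2. d < real (power_dist k (p n \<omega>))"
proof -
  have "AE \<omega> in M. \<forall>i::nat. \<forall>\<^sub>F n in sequentially. \<forall>k\<ge>2. real i < real (power_dist k (p n \<omega>))"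
    unfolding AE_all_countable by (intro allI AE_eventually_far_from_powers of_nat_0_le_iff)
  thus ?thesis
  proof eventually_elim
    case (elim \<omega>)
    show ?case
    proof
      fix d :: real
      obtain i :: nat where i: "d \<le> real i" using real_arch_simple by blast
      from elim obtain B where "\<forall>n\<ge>B. \<forall>k\<ge>2. real i < real (power_dist k (p n \<omega>))"
        unfolding eventually_sequentially by blast
      hence "\<forall>n>B. \<forall>k\<ge>2. d < real (power_dist k (p n \<omega>))"
        using i by (meson less_imp_le order_le_less_trans)
      thus "\<exists>B. \<forall>n>B. \<forall>k\<ge>2. d < real (power_dist k (p n \<omega>))" ..
    qed
  qed
qed

end

section \<open>Assembly of the four almost sure statements\<close>

lemma perfect_power_power_dist:
  assumes "perfect_power (int x)"
  obtains k where "k \<ge> 2" "power_dist k x = 0"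
proof -
  from assms obtain m :: int and k where k: "k \<ge> 2" "int x = m ^ k"
    unfolding perfect_power_def by blast
  hence "power_dist k x = 0" using power_dist_le[of k x m] by simp
  thus ?thesis using that k by blast
qed

theorem theorem1p3:
  fixes M :: "'a measure" and p :: "nat \<Rightarrow> 'a \<Rightarrow> nat" and \<epsilon> :: "nat \<Rightarrow> real"
  assumes "prob_space M"
    and "\<And>n. n \<ge> 1 \<Longrightarrow> \<epsilon> n > 0"
    and "\<epsilon> \<longlonglongrightarrow> 0"
    and "\<epsilon> \<in> \<Omega>(\<lambda>n. ln (HR n) / sqrt (HR n))"
    and "\<And>n. n \<ge> 1 \<Longrightarrow> p n \<in> measurable M (count_space UNIV)"
    and "\<And>n m. n \<ge> 1 \<Longrightarrow> \<P>(\<omega> in M. p n \<omega> = m) =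
           (if m \<in> near_set \<epsilon> n then 1 / real (card (near_set \<epsilon> n)) else 0)"
  shows "(AE \<omega> in M. \<forall>d\<ge>0. \<forall>k\<ge>2. last_close (\<lambda>n. p n \<omega>) k d \<noteq> \<infinity>) \<and>
          (AE \<omega> in M. finite {n. n \<ge> 1 \<and> perfect_power (int (p n \<omega>))}) \<and>
          (AE \<omega> in M. \<forall>k\<ge>2. \<epsilon> \<in> \<Omega>(\<lambda>n. HR n powr (- 1 / real k)) \<longrightarrow>
           (\<forall>e>0. \<forall>\<^sub>F d in at_top.
              ereal_of_enat (last_close (\<lambda>n. p n \<omega>) k d) <
              ereal ((4 + e) * (3 / (2 * pi\<^sup>2)) * (real k / (real k - 1))\<^sup>2 * (ln d)\<^sup>2)) \<and>
           (\<lambda>d. real (the_enat (last_close (\<lambda>n. p n \<omega>) k d))) \<in> \<Theta>(\<lambda>d. (ln d)\<^sup>2)) \<and>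
          (AE \<omega> in M. \<forall>d\<ge>0. \<exists>B::nat. \<forall>k\<ge>2. last_close (\<lambda>n. p n \<omega>) k d \<le> enat B)"
proof -
  interpret uniform_near_HR M p \<epsilon>
    using assms by (intro uniform_near_HR.intro uniform_near_HR_axioms.intro)
  \<comment> \<open>This is (d); dropping the uniformity in \<open>k\<close> gives (a).\<close>
  have close: "AE \<omega> in M. \<forall>d\<ge>0. \<exists>B::nat. \<forall>k\<ge>2. last_close (\<lambda>n. p n \<omega>) k d \<le> enat B"
    using AE_all_far_from_powers
  proof eventually_elim
    case (elim \<omega>)
    show ?case
    proof (intro allI impI)
      fix d :: real assume "d \<ge> 0"
      from elim obtain B where "\<forall>n>B. \<forall>k\<ge>2. d < real (power_dist k (p n \<omega>))" by blast
      thus "\<exists>B::nat. \<forall>k\<ge>2. last_close (\<lambda>n. p n \<omega>) k d \<le> enat B"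
        by (intro exI[of _ B] allI impI last_close_le) auto
    qed
  qed
  moreover from close
  have "AE \<omega> in M. \<forall>d\<ge>0. \<forall>k\<ge>2. last_close (\<lambda>n. p n \<omega>) k d \<noteq> \<infinity>"
  proof eventually_elim
    case (elim \<omega>)
    show ?case
    proof (intro allI impI)
      fix d :: real and k :: nat assume "d \<ge> 0" "k \<ge> 2"
      with elim obtain B where "last_close (\<lambda>n. p n \<omega>) k d \<le> enat B" by blast
      thus "last_close (\<lambda>n. p n \<omega>) k d \<noteq> \<infinity>"
        by (cases "last_close (\<lambda>n. p n \<omega>) k d") simp_all
    qed
  qed
  moreover have "AE \<omega> in M. finite {n. n \<ge> 1 \<and> perfect_power (int (p n \<omega>))}"
    using AE_all_far_from_powers
  proof eventually_elim
    case (elim \<omega>)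
    \<comment> \<open>Perfect powers are the numbers at distance 0 from a \<open>k\<close>-th power
      for some \<open>k \<ge> 2\<close>, so radius 0 gives (b).\<close>
    from elim[rule_format, of 0] obtain B
      where B: "\<forall>n>B. \<forall>k\<ge>2. 0 < real (power_dist k (p n \<omega>))" by blast
    have "{n. n \<ge> 1 \<and> perfect_power (int (p n \<omega>))} \<subseteq> {..B}"
    proof safe
      fix n assume "perfect_power (int (p n \<omega>))"
      then obtain k where "k \<ge> 2" "power_dist k (p n \<omega>) = 0" by (rule perfect_power_power_dist)
      thus "n \<le> B" using B by (metis less_irrefl not_le of_nat_0)
    qed
    thus ?case using finite_subset by blast
  qed
  moreover have "AE \<omega> in M. \<forall>k\<ge>2. \<epsilon> \<in> \<Omega>(\<lambda>n. HR n powr (- 1 / real k)) \<longrightarrow>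
           (\<forall>e>0. \<forall>\<^sub>F d in at_top.
              ereal_of_enat (last_close (\<lambda>n. p n \<omega>) k d) <
              ereal ((4 + e) * (3 / (2 * pi\<^sup>2)) * (real k / (real k - 1))\<^sup>2 * (ln d)\<^sup>2)) \<and>
           (\<lambda>d. real (the_enat (last_close (\<lambda>n. p n \<omega>) k d))) \<in> \<Theta>(\<lambda>d. (ln d)\<^sup>2)"
    \<comment> \<open>Only \<open>k\<close> needs a countable intersection of almost sure events:
      for a fixed realization the deterministic lemmas cover all \<open>e\<close> and
      \<open>d\<close> at once.\<close>
    unfolding AE_all_countable
  proof
    fix k :: nat
    show "AE \<omega> in M. 2 \<le> k \<longrightarrow> \<epsilon> \<in> \<Omega>(\<lambda>n. HR n powr (- 1 / real k)) \<longrightarrow>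
           (\<forall>e>0. \<forall>\<^sub>F d in at_top.
              ereal_of_enat (last_close (\<lambda>n. p n \<omega>) k d) <
              ereal ((4 + e) * (3 / (2 * pi\<^sup>2)) * (real k / (real k - 1))\<^sup>2 * (ln d)\<^sup>2)) \<and>
           (\<lambda>d. real (the_enat (last_close (\<lambda>n. p n \<omega>) k d))) \<in> \<Theta>(\<lambda>d. (ln d)\<^sup>2)"
    proof (cases "2 \<le> k \<and> \<epsilon> \<in> \<Omega>(\<lambda>n. HR n powr (- 1 / real k))")
      case True
      with AE_eventually_far_from_kth_powers
      have "AE \<omega> in M. \<forall>\<^sub>F n in sequentially.
           HR n powr ((real k - 1) / real k / 2) < real (power_dist k (p n \<omega>))" by blast
      thus ?thesis
        using AE_in_near_set
      proof eventually_elim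
        case (elim \<omega>)
        have "\<forall>\<^sub>F n in sequentially. real (p n \<omega>) \<le> 2 * HR n"
          using eventually_regular
        proof eventually_elim
          case n: (elim n)
          have "real (p n \<omega>) \<le> HR n * (1 + \<epsilon> n)"
            using elim n by (simp add: near_set_def)
          also have "\<dots> \<le> HR n * 2" using n by (intro mult_left_mono) auto
          finally show ?case by simp
        qed
        thus ?case
          using True elim(1)
          by (intro impI conjI allI last_close_upper last_close_bigtheta) simp_all
      qed
    qed auto
  qed
  ultimately show ?thesis by blast
qed

end
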